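(* Let $\sigma$ be the Kleinian $\sigma$-function of an $(N,s)$-curve $C$ of genus $g$. For every $n\ge 1$ and all indices $i_1\le\dots\le i_n$ in $\{1,\dots,g\}$, the $n$-index $Q$-function $$Q_{i_1,\dots,i_n}=\left(-\frac{1}{2\sigma^2}\right)\Bigl(S\circ\mathcal{D}_{i_1}\circ\cdots\circ\mathcal{D}_{i_n}(\sigma\otimes\sigma)\Bigr)$$ is Abelian, i.e. it is a standard Abelian function associated with $C$.
   Context: Curve. Let $2\le N<s$ be coprime integers. An $(N,s)$-curve $C$ is the plane algebraic curve $f(x,y)=0$ with $f(x,y)=y^N+q_1(x)y^{N-1}+\dots+q_{N-1}(x)y-q_N(x)$, where each $q_j$ is a polynomial of degree at most $\lfloor js/N\rfloor$, $q_N$ is monic of degree $s$, and $C$ is non-singular; $C$ also denotes the compact Riemann surface it defines, which has a single point $\infty$ at infinity and genus $g=\frac12(N-1)(s-1)\ge 1$. (The integer $N$ has nothing to do with the number $n$ of indices.) Periods. Let $du_1,\dots,du_g$ be the standard basis $h_i\,dx/f_y$ ($h_i$ monomials in $x,y$) of holomorphic differentials on $C$, and $\bm{du}=(du_1,\dots,du_g)$. Let $\alpha_1,\dots,\alpha_g,\beta_1,\dots,\beta_g$ be a symplectic basis of $H_1(C,\mathbb{Z})$ ($\alpha_i\cdot\alpha_j=\beta_i\cdot\beta_j=0$, $\alpha_i\cdot\beta_j=\delta_{ij}$). Let $dr_1,\dots,dr_g$ be the associated basis of differentials of the second kind, with only pole at $\infty$. Let $\omega',\omega'',\eta',\eta''$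 be the $g\times g$ matrices with $(k,\ell)$ entries $\oint_{\alpha_\ell}du_k$, $\oint_{\beta_\ell}du_k$, $\oint_{\alpha_\ell}dr_k$, $\oint_{\beta_\ell}dr_k$, the $dr_k$ being normalised so that the generalised Legendre relation holds: $\eta'(\omega')^{-1}$ is symmetric and $\eta''=\eta'(\omega')^{-1}\omega''-2\pi i((\omega')^{-1})^T$. Let $\Lambda=\{\omega'\bm m+\omega''\bm n:\bm m,\bm n\in\mathbb{Z}^g\}\subset\mathbb{C}^g$, $J=\mathbb{C}^g/\Lambda$, $\kappa:\mathbb{C}^g\to J$ the quotient map. Let $W^{[k]}\subset J$ be the set of points $\int_\infty^{P_1}\bm{du}+\dots+\int_\infty^{P_k}\bm{du}$ mod $\Lambda$ with $P_i\in C$, and $\Theta^{[k]}=W^{[k]}\cup(-W^{[k]})$. $\sigma$-function. Let $\bm\delta=\omega'\bm\delta'+\omega''\bm\delta''$ ($\bm\delta',\bm\delta''\in\mathbb{R}^g$) be the Riemann constant with base point $\infty$. Put $\tau=(\omega')^{-1}\omega''$, $z=(\omega')^{-1}\bm u$ and $$\sigma(\bm u)=c\,\exp\bigl(\tfrac12\bm u^T\eta'(\omega')^{-1}\bm u\bigr)\sum_{\bm m\in\mathbb{Z}^g}\exp\Bigl[2\pi i\bigl\{\tfrac12(\bm m+\bm\delta'')^T\tau(\bm m+\bm\delta'')+(\bm m+\bm\delta'')^T(z+\bm\delta')\bigr\}\Bigr],$$ with $c\ne0$ a constant. Recalled known facts: $\sigma$ is entire on $\mathbb{C}^g$; it vanishes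 exactly along $\kappa^{-1}(\Theta^{[g-1]})$, with order one; and for $\bm\ell=\omega'\bm\ell'+\omega''\bm\ell''\in\Lambda$ ($\bm\ell',\bm\ell''\in\mathbb{Z}^g$), $\sigma(\bm u+\bm\ell)=\chi(\bm\ell)\,e^{L(\bm u)}\sigma(\bm u)$, where $L(\bm u)=(\bm u+\frac{\bm\ell}{2})^T(\eta'\bm\ell'+\eta''\bm\ell'')$ and $\chi(\bm\ell)=\exp[2\pi i\{(\bm\ell')^T\bm\delta''-(\bm\ell'')^T\bm\delta'+\frac12(\bm\ell')^T\bm\ell''\}]$. Abelian functions. A meromorphic function $\mathfrak{M}$ on $\mathbb{C}^g$ is a standard Abelian function associated with $C$ if its poles lie only along $\kappa^{-1}(\Theta^{[g-1]})$ and $\mathfrak{M}(\bm u+\bm\ell)=\mathfrak{M}(\bm u)$ for all $\bm\ell\in\Lambda$. Operators. Let $F$ be the $\mathbb{C}$-algebra of entire functions of $\bm u=(u_1,\dots,u_g)$; tensor products are over $\mathbb{C}$. The Baker--Hirota operator $\mathcal{D}_i$ is the linear map $F\otimes F\to F\otimes F$ with $\mathcal{D}_i(f\otimes g)=\frac{\partial f}{\partial u_i}\otimes g-f\otimes\frac{\partial g}{\partial u_i}$; $S:F\otimes F\to F$ is the linear map $S(f\otimes g)=fg$. *)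

theory Defs
  imports
    "HOL-Complex_Analysis.Complex_Analysis"
    "HOL-Homology.Homology"
    "HOL-Library.Poly_Mapping"
begin

no_notation fps_nth (infixl \<open>$\<close> 75)

section \<open>Functions of several complex variables\<close>

text \<open>These synonyms impose no sort on \<open>'g\<close>, unlike the notation \<open>complex^'g\<close>, which fixes the sort
  \<open>finite\<close>; the index type of the curve also carries a linear order.\<close>

type_synonym 'g cvector = "(complex, 'g) vec"
type_synonym 'g cmatrix = "((complex, 'g) vec, 'g) vec"

definition holomorphic_cn :: "(complex^'g::finite) set \<Rightarrow> (complex^'g \<Rightarrow> complex) \<Rightarrow> bool" where
  "holomorphic_cn U f \<longleftrightarrow>
     (\<forall>u\<in>U. \<exists>D. (f has_derivative D) (at u) \<and> (\<forall>c v. D (c *s v) = c * D v))"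

abbreviation entire_cn :: "(complex^'g::finite \<Rightarrow> complex) \<Rightarrow> bool" where
  "entire_cn \<equiv> holomorphic_cn UNIV"

definition partial :: "'g::finite \<Rightarrow> (complex^'g \<Rightarrow> complex) \<Rightarrow> complex^'g \<Rightarrow> complex" where
  "partial i f u = deriv (\<lambda>z. f (u + axis i z)) 0"

text \<open>A meromorphic function is represented by a total function. Locally it is a quotient of
  holomorphic functions whose denominator vanishes on no nonempty open set; its values at the
  zeros of the denominator are irrelevant.\<close>

definition meromorphic_cn :: "(complex^'g::finite \<Rightarrow> complex) \<Rightarrow> bool" where
  "meromorphic_cn M \<longleftrightarrow>
     (\<forall>p. \<exists>U A B. open U \<and> p \<in> U \<and> holomorphic_cn U A \<and> holomorphic_cn U B \<and>
        (\<forall>V. open V \<and> V \<subseteq> U \<and> V \<noteq> {} \<longrightarrow> (\<exists>v\<in>V. B v \<noteq> 0)) \<and>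
        (\<forall>u\<in>U. B u \<noteq> 0 \<longrightarrow> M u = A u / B u))"

text \<open>Order one along the divisor: the zeros at which the differential does not vanish are dense
  in the zero set, i.e. every component of the zero divisor has multiplicity one.\<close>

definition vanishes_exactly_along_order_one ::
    "(complex^'g::finite \<Rightarrow> complex) \<Rightarrow> (complex^'g) set \<Rightarrow> bool" where
  "vanishes_exactly_along_order_one f Z \<longleftrightarrow>
     {u. f u = 0} = Z \<and>
     (\<forall>U. open U \<and> U \<inter> Z \<noteq> {} \<longrightarrow> (\<exists>u \<in> U \<inter> Z. \<exists>i. partial i f u \<noteq> 0))"

lemma holomorphic_cn_continuous:
  assumes "holomorphic_cn U f" "u \<in> U"
  shows "isCont f u"
  using assms unfolding holomorphic_cn_def by (metis has_derivative_continuous)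

lemma bounded_linear_axis: "bounded_linear (axis i :: complex \<Rightarrow> complex^'g::finite)"
  unfolding linear_conv_bounded_linear[symmetric]
proof (rule linearI)
  fix x y :: complex and r :: real
  show "(axis i (x + y) :: complex^'g) = axis i x + axis i y"
    by (rule vec_eq_iff[THEN iffD2]) (auto simp: axis_def)
  show "(axis i (r *\<^sub>R x) :: complex^'g) = r *\<^sub>R axis i x"
    by (rule vec_eq_iff[THEN iffD2]) (auto simp: axis_def)
qed

lemma holomorphic_cn_line:
  fixes f :: "complex^'g::finite \<Rightarrow> complex"
  assumes "(f has_derivative D) (at (u + axis i z))" "\<And>c v. D (c *s v) = c * D v"
  shows "((\<lambda>z. f (u + axis i z)) has_field_derivative D (axis i 1)) (at z)"
proof -
  have "((\<lambda>z. u + axis i z) has_derivative (axis i :: complex \<Rightarrow> complex^'g)) (at z)"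
    using has_derivative_add[OF has_derivative_const[of u]
        bounded_linear_imp_has_derivative[OF bounded_linear_axis]] by simp
  from diff_chain_at[OF this assms(1)]
  have 1: "((\<lambda>z. f (u + axis i z)) has_derivative (\<lambda>z. D (axis i z))) (at z)" by (simp add: o_def)
  have "D (axis i w) = D (axis i 1) * w" for w
  proof -
    have "axis i w = w *s (axis i 1 :: complex^'g)"
      by (rule vec_eq_iff[THEN iffD2]) (auto simp: axis_def)
    then show ?thesis using assms(2)[of w "axis i 1"] by simp
  qed
  then have "(\<lambda>z. D (axis i z)) = (*) (D (axis i 1))" by (rule ext)
  with 1 show ?thesis by (simp only: has_field_derivative_def)
qed

lemma partial_eq:
  assumes "(f has_derivative D) (at u)" "\<And>c v. D (c *s v) = c * D v"
  shows "partial i f u = D (axis i 1)"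
proof -
  have "u + axis i (0::complex) = u" by simp
  with assms(1) have "(f has_derivative D) (at (u + axis i 0))" by (simp only:)
  from holomorphic_cn_line[OF this assms(2)] show ?thesis
    unfolding partial_def by (rule DERIV_imp_deriv)
qed

lemma holomorphic_cn_has_derivative:
  fixes f :: "complex^'g::finite \<Rightarrow> complex"
  assumes "holomorphic_cn U f" "u \<in> U"
  shows "(f has_derivative (\<lambda>v. \<Sum>i\<in>UNIV. partial i f u * (v $ i))) (at u)"
proof -
  from assms obtain D where D: "(f has_derivative D) (at u)" "\<And>c v. D (c *s v) = c * D v"
    unfolding holomorphic_cn_def by blast
  interpret bounded_linear D using D(1) by (rule has_derivative_bounded_linear)
  have "D v = (\<Sum>i\<in>UNIV. partial i f u * (v $ i))" for v
  proof -
    have "D v = D (\<Sum>i\<in>UNIV. v $ i *s axis i 1)" by (simp add: basis_expansion)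
    also have "\<dots> = (\<Sum>i\<in>UNIV. v $ i * D (axis i 1))" by (simp add: sum D(2))
    finally show ?thesis by (simp add: partial_eq[OF D] mult.commute)
  qed
  then have "D = (\<lambda>v. \<Sum>i\<in>UNIV. partial i f u * (v $ i))" by auto
  with D(1) show ?thesis by simp
qed

lemma holomorphic_cnI:
  fixes f :: "complex^'g::finite \<Rightarrow> complex"
  assumes "\<And>u. u \<in> U \<Longrightarrow> (f has_derivative (\<lambda>v. \<Sum>i\<in>UNIV. d u i * (v $ i))) (at u)"
  shows "holomorphic_cn U f"
  unfolding holomorphic_cn_def
proof
  fix u assume "u \<in> U"
  from assms[OF this] show "\<exists>D. (f has_derivative D) (at u) \<and> (\<forall>c v. D (c *s v) = c * D v)"
    by (intro exI conjI) (auto simp: sum_distrib_left mult_ac)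
qed

lemma partial_eqI:
  fixes f :: "complex^'g::finite \<Rightarrow> complex"
  assumes "(f has_derivative (\<lambda>v. \<Sum>i\<in>UNIV. d i * (v $ i))) (at u)"
  shows "partial i f u = d i"
proof -
  have "partial i f u = (\<Sum>j\<in>UNIV. d j * (axis i 1 $ j))"
    by (rule partial_eq[OF assms]) (auto simp: sum_distrib_left mult_ac)
  also have "\<dots> = d i" by (simp add: axis_def if_distrib cong: if_cong)
  finally show ?thesis .
qed

lemma partial_cauchy:
  fixes f :: "complex^'g::finite \<Rightarrow> complex"
  assumes "entire_cn f"
  shows "partial i f u =
    integral {0..1} (\<lambda>t. f (u + axis i (circlepath 0 1 t)) / circlepath 0 1 t)"
proof -
  let ?g = "\<lambda>z. f (u + axis i z)"
  have hol: "?g holomorphic_on UNIV"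
  proof (rule holomorphic_onI)
    fix z
    from assms obtain D where "(f has_derivative D) (at (u + axis i z))"
      "\<And>c v. D (c *s v) = c * D v" unfolding holomorphic_cn_def by blast
    from holomorphic_cn_line[OF this] show "?g field_differentiable at z within UNIV"
      by (auto simp: field_differentiable_def)
  qed
  have "((\<lambda>z. ?g z / (z - 0) ^ Suc 1) has_contour_integral
      (2 * pi * \<i>) / fact 1 * (deriv ^^ 1) ?g 0) (circlepath 0 1)"
  proof (rule Cauchy_has_contour_integral_higher_derivative_circlepath)
    show "continuous_on (cball 0 1) ?g"
      by (rule holomorphic_on_imp_continuous_on[OF holomorphic_on_subset[OF hol subset_UNIV]])
    show "?g holomorphic_on ball 0 1" by (rule holomorphic_on_subset[OF hol subset_UNIV])
  qed simp
  then have "((\<lambda>t. ?g (circlepath 0 1 t) / (circlepath 0 1 t) ^ 2 *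
      vector_derivative (circlepath 0 1) (at t within {0..1})) has_integral
      2 * pi * \<i> * partial i f u) {0..1}"
    by (simp add: has_contour_integral_def partial_def numeral_2_eq_2)
  then have "((\<lambda>t. 2 * pi * \<i> * (?g (circlepath 0 1 t) / circlepath 0 1 t)) has_integral
      2 * pi * \<i> * partial i f u) {0..1}"
  proof (rule has_integral_eq[rotated])
    fix t :: real assume t: "t \<in> {0..1}"
    have "vector_derivative (circlepath 0 1) (at t within {0..1}) = 2 * pi * \<i> * circlepath 0 1 t"
      using vector_derivative_circlepath01[of t 0 1] t by (simp add: circlepath)
    then show "?g (circlepath 0 1 t) / (circlepath 0 1 t)\<^sup>2 *
        vector_derivative (circlepath 0 1) (at t within {0..1}) =
        2 * pi * \<i> * (?g (circlepath 0 1 t) / circlepath 0 1 t)"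
      by (simp add: power2_eq_square circlepath)
  qed
  then have "((\<lambda>t. ?g (circlepath 0 1 t) / circlepath 0 1 t) has_integral partial i f u) {0..1}"
    by (subst (asm) has_integral_mult_right_iff) simp_all
  then show ?thesis by (simp add: integral_unique)
qed

lemma entire_cn_partial:
  fixes f :: "complex^'g::finite \<Rightarrow> complex"
  assumes f: "entire_cn f"
  shows "entire_cn (partial i f)"
proof -
  let ?e = "\<lambda>i t. axis i (circlepath 0 1 t) :: complex^'g"
  let ?k = "\<lambda>t. 1 / circlepath 0 1 t"
  have contf: "continuous_on A f" for A
    using holomorphic_cn_continuous[OF f] by (simp add: continuous_at_imp_continuous_on)
  have ce [continuous_intros]: "continuous_on A (?e i)" for A i
    by (intro bounded_linear.continuous_on[OF bounded_linear_axis])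
      (auto simp: circlepath intro!: continuous_intros)
  have ck [continuous_intros]: "continuous_on A ?k" for A
    by (auto simp: circlepath intro!: continuous_intros)
  have comp2: "continuous_on A (\<lambda>x. g (fst x + ?e i (snd x)) * ?k (snd x))"
    if "continuous_on UNIV g" for A g i
    by (intro continuous_on_mult continuous_on_compose2[OF that]
        continuous_on_compose2[OF ck[of UNIV], of _ snd] continuous_on_add
        continuous_on_compose2[OF ce[of UNIV], of _ snd] continuous_on_fst continuous_on_snd
        continuous_on_id) auto
  have cp: "continuous_on UNIV (partial j f)" for j
  proof -
    have "continuous_on UNIV (\<lambda>u. integral (cbox 0 1) (\<lambda>t. f (u + ?e j t) * ?k t))"
      by (rule integral_continuous_on_param)
        (use comp2[of f] contf in \<open>auto simp: split_beta\<close>)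
    then show ?thesis using partial_cauchy[OF f, of j] by (simp add: fun_eq_iff cbox_interval)
  qed
  define pr :: "'g \<Rightarrow> ((complex^'g) \<Rightarrow>\<^sub>L complex)" where "pr j = Blinfun (\<lambda>v. v $ j)" for j
  have pr: "blinfun_apply (pr j) v = v $ j" for j v
    unfolding pr_def by (simp add: bounded_linear_Blinfun_apply bounded_linear_vec_nth)
  define G where "G u t = (\<Sum>j\<in>UNIV. blinfun_mult_right (partial j f (u + ?e i t) * ?k t) o\<^sub>L pr j)"
    for u t
  have G: "blinfun_apply (G u t) v = (\<Sum>j\<in>UNIV. partial j f (u + ?e i t) * ?k t * (v $ j))" for u t v
    by (simp add: G_def blinfun.sum_left pr)
  have contG: "continuous_on A (\<lambda>x. G (fst x) (snd x))" for A
    unfolding G_def by (intro continuous_intros comp2[OF cp])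
  have contG1: "continuous_on A (\<lambda>t. G u t)" for A u
  proof -
    have "continuous_on A (\<lambda>t. G (fst (u, t)) (snd (u, t)))"
      by (rule continuous_on_compose2[OF contG[of UNIV]])
        (simp_all add: continuous_on_Pair continuous_on_const continuous_on_id)
    then show ?thesis by simp
  qed
  have der: "((\<lambda>u. f (u + ?e i t) * ?k t) has_derivative blinfun_apply (G u t)) (at u)" for u t
  proof -
    have "(f has_derivative (\<lambda>v. \<Sum>j\<in>UNIV. partial j f (u + ?e i t) * (v $ j))) (at (u + ?e i t))"
      by (rule holomorphic_cn_has_derivative[OF f]) simp
    moreover have "((\<lambda>u. u + ?e i t) has_derivative (\<lambda>v. v)) (at u)"
      by (auto intro!: derivative_eq_intros)
    ultimately have "((\<lambda>u. f (u + ?e i t)) has_derivative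
        (\<lambda>v. \<Sum>j\<in>UNIV. partial j f (u + ?e i t) * (v $ j))) (at u)"
      using diff_chain_at by (fastforce simp: o_def)
    from has_derivative_mult_left[OF this, of "?k t"] show ?thesis
      by (simp add: G[abs_def] sum_divide_distrib mult_ac)
  qed
  have "(partial i f has_derivative (\<lambda>v. \<Sum>j\<in>UNIV.
      integral {0..1} (\<lambda>t. partial j f (u + ?e i t) * ?k t) * (v $ j))) (at u)" for u
  proof -
    have intg: "(\<lambda>t. g (u + ?e i t) * ?k t) integrable_on {0..1}" if "continuous_on UNIV g" for g u
      by (intro integrable_continuous_interval continuous_on_mult ck
          continuous_on_compose2[OF that] continuous_on_add continuous_on_const ce) auto
    have D: "((\<lambda>u. integral (cbox 0 1) (\<lambda>t. f (u + ?e i t) * ?k t)) has_derivative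
        blinfun_apply (integral (cbox 0 1) (G u))) (at u within UNIV)"
      by (rule leibniz_rule[OF _ _ _ _ convex_UNIV])
        (use der intg[OF contf] contG in \<open>auto simp: split_beta cbox_interval\<close>)
    have "blinfun_apply (integral (cbox 0 1) (G u)) v =
        (\<Sum>j\<in>UNIV. integral {0..1} (\<lambda>t. partial j f (u + ?e i t) * ?k t) * (v $ j))" for v
    proof -
      have "blinfun_apply (integral (cbox 0 1) (G u)) v = integral (cbox 0 1) (\<lambda>t. G u t v)"
        by (rule blinfun_apply_integral) (rule integrable_continuous[OF contG1])
      also have "\<dots> = integral {0..1}
          (\<lambda>t. \<Sum>j\<in>UNIV. partial j f (u + ?e i t) * ?k t * (v $ j))"
        by (simp add: G cbox_interval)
      also have "\<dots> = (\<Sum>j\<in>UNIV. integral {0..1}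
          (\<lambda>t. partial j f (u + ?e i t) * ?k t * (v $ j)))"
        by (rule integral_sum[OF finite_class.finite_UNIV integrable_on_mult_left[OF intg[OF cp]]])
      also have "\<dots> = (\<Sum>j\<in>UNIV. integral {0..1} (\<lambda>t. partial j f (u + ?e i t) * ?k t) * (v $ j))"
        by (rule sum.cong) (simp_all only: integral_mult_left)
      finally show ?thesis .
    qed
    then have "blinfun_apply (integral (cbox 0 1) (G u)) =
        (\<lambda>v. \<Sum>j\<in>UNIV. integral {0..1} (\<lambda>t. partial j f (u + ?e i t) * ?k t) * (v $ j))" ..
    moreover have "partial i f = (\<lambda>u. integral (cbox 0 1) (\<lambda>t. f (u + ?e i t) * ?k t))"
      by (rule ext) (simp add: partial_cauchy[OF f] cbox_interval)
    ultimately show ?thesis using D by (simp only: cbox_interval)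
  qed
  then show ?thesis by (rule holomorphic_cnI)
qed


section \<open>The algebra of entire functions, its tensor square and the Baker--Hirota operators\<close>

lemma entire_cn_arith:
  fixes f h :: "complex^'g::finite \<Rightarrow> complex"
  assumes f: "entire_cn f" and h: "entire_cn h"
  shows "entire_cn (\<lambda>u. f u + h u)" "partial i (\<lambda>u. f u + h u) = (\<lambda>u. partial i f u + partial i h u)"
    and "entire_cn (\<lambda>u. f u * h u)"
proof -
  have df: "(f has_derivative (\<lambda>v. \<Sum>i\<in>UNIV. partial i f u * (v $ i))) (at u)" for u
    by (rule holomorphic_cn_has_derivative[OF f UNIV_I])
  have dh: "(h has_derivative (\<lambda>v. \<Sum>i\<in>UNIV. partial i h u * (v $ i))) (at u)" for u
    by (rule holomorphic_cn_has_derivative[OF h UNIV_I])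
  have a: "((\<lambda>u. f u + h u) has_derivative
      (\<lambda>v. \<Sum>i\<in>UNIV. (partial i f u + partial i h u) * (v $ i))) (at u)" for u
    using has_derivative_add[OF df dh] by (simp add: sum.distrib distrib_right)
  show "entire_cn (\<lambda>u. f u + h u)" by (rule holomorphic_cnI) (rule a)
  show "partial i (\<lambda>u. f u + h u) = (\<lambda>u. partial i f u + partial i h u)"
    by (rule ext) (rule partial_eqI[OF a])
  have m: "((\<lambda>u. f u * h u) has_derivative
      (\<lambda>v. \<Sum>i\<in>UNIV. (f u * partial i h u + partial i f u * h u) * (v $ i))) (at u)" for u
    using has_derivative_mult[OF df dh]
    by (simp add: sum.distrib distrib_right distrib_left sum_distrib_left sum_distrib_right mult_ac)
  show "entire_cn (\<lambda>u. f u * h u)" by (rule holomorphic_cnI) (rule m)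
qed

lemma entire_cn_const: "entire_cn (\<lambda>u :: complex^'g::finite. c)"
  by (rule holomorphic_cnI[where d = "\<lambda>_ _. 0"]) simp

lemma entire_cn_scale:
  fixes f :: "complex^'g::finite \<Rightarrow> complex"
  assumes f: "entire_cn f"
  shows "entire_cn (\<lambda>u. c * f u)" "partial i (\<lambda>u. c * f u) = (\<lambda>u. c * partial i f u)"
proof -
  have a: "((\<lambda>u. c * f u) has_derivative
      (\<lambda>v. \<Sum>i\<in>UNIV. (c * partial i f u) * (v $ i))) (at u)" for u
    using has_derivative_mult_right[OF holomorphic_cn_has_derivative[OF f UNIV_I], of c u]
    by (simp add: sum_distrib_left mult_ac)
  show "entire_cn (\<lambda>u. c * f u)" by (rule holomorphic_cnI) (rule a)
  show "partial i (\<lambda>u. c * f u) = (\<lambda>u. c * partial i f u)"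
    by (rule ext) (rule partial_eqI[OF a])
qed

typedef (overloaded) ('g::finite) entire_fun = "{f :: complex^'g \<Rightarrow> complex. entire_cn f}"
  morphisms fun_of Entire
  using entire_cn_const by blast

setup_lifting type_definition_entire_fun

instantiation entire_fun :: (finite) comm_ring_1
begin
lift_definition zero_entire_fun :: "'a entire_fun" is "\<lambda>u. 0" by (rule entire_cn_const)
lift_definition one_entire_fun :: "'a entire_fun" is "\<lambda>u. 1" by (rule entire_cn_const)
lift_definition plus_entire_fun :: "'a entire_fun \<Rightarrow> 'a entire_fun \<Rightarrow> 'a entire_fun"
  is "\<lambda>f h u. f u + h u" by (rule entire_cn_arith)
lift_definition uminus_entire_fun :: "'a entire_fun \<Rightarrow> 'a entire_fun"
  is "\<lambda>f u. - f u" using entire_cn_scale(1)[of _ "-1"] by simp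
lift_definition minus_entire_fun :: "'a entire_fun \<Rightarrow> 'a entire_fun \<Rightarrow> 'a entire_fun"
  is "\<lambda>f h u. f u - h u" using entire_cn_arith(1)[OF _ entire_cn_scale(1)[of _ "-1"]] by simp
lift_definition times_entire_fun :: "'a entire_fun \<Rightarrow> 'a entire_fun \<Rightarrow> 'a entire_fun"
  is "\<lambda>f h u. f u * h u" by (rule entire_cn_arith)
instance
proof
  show "(0::'a entire_fun) \<noteq> 1" by transfer (simp add: fun_eq_iff)
qed (transfer; simp add: fun_eq_iff algebra_simps)+
end

lift_definition scale_entire :: "complex \<Rightarrow> ('g::finite) entire_fun \<Rightarrow> 'g entire_fun"
  is "\<lambda>c f u. c * f u" by (rule entire_cn_scale)

lift_definition partial_entire :: "'g::finite \<Rightarrow> 'g entire_fun \<Rightarrow> 'g entire_fun"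
  is partial by (rule entire_cn_partial)

interpretation entire: vector_space scale_entire
  by unfold_locales (transfer; simp add: fun_eq_iff algebra_simps)+

lemma partial_entire_add: "partial_entire i (f + h) = partial_entire i f + partial_entire i h"
  by transfer (rule entire_cn_arith)

lemma partial_entire_scale: "partial_entire i (scale_entire c f) = scale_entire c (partial_entire i f)"
  by transfer (rule entire_cn_scale)

text \<open>The tensor square is constructed as the free complex vector space on pairs of entire functions,
  modulo the span of the bilinearity relations.\<close>

definition free_scale :: "complex \<Rightarrow> ('a \<Rightarrow>\<^sub>0 complex) \<Rightarrow> ('a \<Rightarrow>\<^sub>0 complex)" where
  "free_scale c = Poly_Mapping.map ((*) c)"

lemma lookup_free_scale: "Poly_Mapping.lookup (free_scale c x) a = c * Poly_Mapping.lookup x a"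
  by (simp add: free_scale_def Poly_Mapping.map.rep_eq when_def)

interpretation free: vector_space "free_scale :: complex \<Rightarrow> ('a \<Rightarrow>\<^sub>0 complex) \<Rightarrow> ('a \<Rightarrow>\<^sub>0 complex)"
  by unfold_locales
    (rule poly_mapping_eqI; simp add: lookup_free_scale lookup_add algebra_simps)+

definition free_extend :: "(complex \<Rightarrow> 'b::ab_group_add \<Rightarrow> 'b) \<Rightarrow> ('a \<Rightarrow> 'b) \<Rightarrow> ('a \<Rightarrow>\<^sub>0 complex) \<Rightarrow> 'b" where
  "free_extend sc \<phi> x = (\<Sum>a\<in>Poly_Mapping.keys x. sc (Poly_Mapping.lookup x a) (\<phi> a))"

lemma free_extend_superset:
  assumes "vector_space sc" "finite A" "Poly_Mapping.keys x \<subseteq> A"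
  shows "free_extend sc \<phi> x = (\<Sum>a\<in>A. sc (Poly_Mapping.lookup x a) (\<phi> a))"
proof -
  interpret vector_space sc by fact
  show ?thesis unfolding free_extend_def
    by (rule sum.mono_neutral_left) (use assms in \<open>auto simp: in_keys_iff\<close>)
qed

lemma vector_space_linearI:
  assumes "vector_space s1" "vector_space s2"
    and "\<And>x y. \<phi> (x + y) = \<phi> x + \<phi> y" "\<And>c x. \<phi> (s1 c x) = s2 c (\<phi> x)"
  shows "Vector_Spaces.linear s1 s2 \<phi>"
  unfolding linear_iff_module_hom module_hom_iff module_iff_vector_space using assms by blast

lemma linear_free_extend:
  fixes \<phi> :: "'a \<Rightarrow> 'b::ab_group_add"
  assumes sc: "vector_space sc"
  shows "Vector_Spaces.linear free_scale sc (free_extend sc \<phi>)"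
proof -
  interpret v: vector_space sc by fact
  show ?thesis
  proof (rule vector_space_linearI[OF free.vector_space_axioms sc])
    fix x y :: "'a \<Rightarrow>\<^sub>0 complex"
    let ?A = "Poly_Mapping.keys x \<union> Poly_Mapping.keys y"
    have "Poly_Mapping.keys (x + y) \<subseteq> ?A" by (rule Poly_Mapping.keys_add)
    then show "free_extend sc \<phi> (x + y) = free_extend sc \<phi> x + free_extend sc \<phi> y"
      by (simp add: free_extend_superset[OF sc, of ?A] lookup_add v.scale_left_distrib sum.distrib)
  next
    fix c and x :: "'a \<Rightarrow>\<^sub>0 complex"
    have "Poly_Mapping.keys (free_scale c x) \<subseteq> Poly_Mapping.keys x"
      by (auto simp: in_keys_iff lookup_free_scale)
    then show "free_extend sc \<phi> (free_scale c x) = sc c (free_extend sc \<phi> x)"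
      by (simp add: free_extend_superset[OF sc, of "Poly_Mapping.keys x"] lookup_free_scale
          v.scale_sum_right)
  qed
qed

lemma free_extend_single:
  assumes "vector_space sc"
  shows "free_extend sc \<phi> (Poly_Mapping.single a c) = sc c (\<phi> a)"
proof -
  interpret v: vector_space sc by fact
  show ?thesis by (simp add: free_extend_superset[OF assms, of "{a}"])
qed

abbreviation formal_tensor ::
    "'g entire_fun \<Rightarrow> 'g entire_fun \<Rightarrow> (('g::finite) entire_fun \<times> 'g entire_fun) \<Rightarrow>\<^sub>0 complex" where
  "formal_tensor f h \<equiv> Poly_Mapping.single (f, h) 1"

definition bilinearity_relations :: "((('g::finite) entire_fun \<times> 'g entire_fun) \<Rightarrow>\<^sub>0 complex) set" where
  "bilinearity_relations =
     {formal_tensor (f + f') h - (formal_tensor f h + formal_tensor f' h) | f f' h. True} \<union>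
     {formal_tensor f (h + h') - (formal_tensor f h + formal_tensor f h') | f h h'. True} \<union>
     {formal_tensor (scale_entire c f) h - free_scale c (formal_tensor f h) | c f h. True} \<union>
     {formal_tensor f (scale_entire c h) - free_scale c (formal_tensor f h) | c f h. True}"

definition tensor_eq ::
    "((('g::finite) entire_fun \<times> 'g entire_fun) \<Rightarrow>\<^sub>0 complex) \<Rightarrow>
     (('g entire_fun \<times> 'g entire_fun) \<Rightarrow>\<^sub>0 complex) \<Rightarrow> bool" where
  "tensor_eq x y \<longleftrightarrow> x - y \<in> free.span bilinearity_relations"

lemma equivp_tensor_eq:
  "equivp (tensor_eq :: ((('g::finite) entire_fun \<times> 'g entire_fun) \<Rightarrow>\<^sub>0 complex) \<Rightarrow> _)"
proof (rule equivpI)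
  show "reflp (tensor_eq :: (('g entire_fun \<times> 'g entire_fun) \<Rightarrow>\<^sub>0 complex) \<Rightarrow> _)" by (auto simp: reflp_def tensor_eq_def free.span_zero)
  show "symp (tensor_eq :: (('g entire_fun \<times> 'g entire_fun) \<Rightarrow>\<^sub>0 complex) \<Rightarrow> _)"
  proof (rule sympI)
    fix x y :: "('g entire_fun \<times> 'g entire_fun) \<Rightarrow>\<^sub>0 complex"
    assume "tensor_eq x y"
    then have "- (x - y) \<in> free.span bilinearity_relations"
      unfolding tensor_eq_def by (rule free.span_neg)
    then show "tensor_eq y x" by (simp add: tensor_eq_def)
  qed
  show "transp (tensor_eq :: (('g entire_fun \<times> 'g entire_fun) \<Rightarrow>\<^sub>0 complex) \<Rightarrow> _)"
  proof (rule transpI)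
    fix x y z :: "('g entire_fun \<times> 'g entire_fun) \<Rightarrow>\<^sub>0 complex"
    assume "tensor_eq x y" "tensor_eq y z"
    then have "(x - y) + (y - z) \<in> free.span bilinearity_relations"
      unfolding tensor_eq_def by (rule free.span_add)
    then show "tensor_eq x z" by (simp add: tensor_eq_def)
  qed
qed

quotient_type (overloaded) 'g tensor =
  "(('g::finite) entire_fun \<times> 'g entire_fun) \<Rightarrow>\<^sub>0 complex" / tensor_eq
  by (rule equivp_tensor_eq)

instantiation tensor :: (finite) ab_group_add
begin
lift_definition zero_tensor :: "'a tensor" is 0 .
lift_definition plus_tensor :: "'a tensor \<Rightarrow> 'a tensor \<Rightarrow> 'a tensor" is "(+)"
proof -
  fix x x' y y' :: "('a entire_fun \<times> 'a entire_fun) \<Rightarrow>\<^sub>0 complex"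
  assume "tensor_eq x x'" "tensor_eq y y'"
  then have "(x - x') + (y - y') \<in> free.span bilinearity_relations"
    unfolding tensor_eq_def by (rule free.span_add)
  then show "tensor_eq (x + y) (x' + y')" by (simp add: tensor_eq_def algebra_simps)
qed
lift_definition uminus_tensor :: "'a tensor \<Rightarrow> 'a tensor" is uminus
proof -
  fix x x' :: "('a entire_fun \<times> 'a entire_fun) \<Rightarrow>\<^sub>0 complex"
  assume "tensor_eq x x'"
  then have "- (x - x') \<in> free.span bilinearity_relations"
    unfolding tensor_eq_def by (rule free.span_neg)
  then show "tensor_eq (- x) (- x')" by (simp add: tensor_eq_def)
qed
lift_definition minus_tensor :: "'a tensor \<Rightarrow> 'a tensor \<Rightarrow> 'a tensor" is "(-)"
proof -
  fix x x' y y' :: "('a entire_fun \<times> 'a entire_fun) \<Rightarrow>\<^sub>0 complex"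
  assume "tensor_eq x x'" "tensor_eq y y'"
  then have "(x - x') - (y - y') \<in> free.span bilinearity_relations"
    unfolding tensor_eq_def by (rule free.span_diff)
  then show "tensor_eq (x - y) (x' - y')" by (simp add: tensor_eq_def algebra_simps)
qed
instance
  by standard (transfer; simp add: tensor_eq_def free.span_zero algebra_simps)+
end

lift_definition scale_tensor :: "complex \<Rightarrow> ('g::finite) tensor \<Rightarrow> 'g tensor" is free_scale
  by (auto simp: tensor_eq_def free.scale_right_diff_distrib[symmetric] free.span_scale)

lift_definition tensor :: "('g::finite) entire_fun \<Rightarrow> 'g entire_fun \<Rightarrow> 'g tensor" (infixr \<open>\<otimes>\<^sub>F\<close> 70)
  is formal_tensor .

interpretation tensor: vector_space scale_tensor
  by unfold_locales (transfer; simp add: tensor_eq_def free.span_zero free.scale_right_distrib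
      free.scale_left_distrib)+

lemma tensor_bilinear:
  "tensor (f + f') h = tensor f h + tensor f' h"
  "tensor f (h + h') = tensor f h + tensor f h'"
  "tensor (scale_entire c f) h = scale_tensor c (tensor f h)"
  "tensor f (scale_entire c h) = scale_tensor c (tensor f h)"
  by (transfer, unfold tensor_eq_def, rule free.span_base, unfold bilinearity_relations_def, blast)+

definition tensor_lift ::
    "(complex \<Rightarrow> 'b::ab_group_add \<Rightarrow> 'b) \<Rightarrow>
     (('g::finite) entire_fun \<Rightarrow> 'g entire_fun \<Rightarrow> 'b) \<Rightarrow> 'g tensor \<Rightarrow> 'b" where
  "tensor_lift sc B x = free_extend sc (case_prod B) (rep_tensor x)"

definition bilinear_map ::
    "(complex \<Rightarrow> 'b::ab_group_add \<Rightarrow> 'b) \<Rightarrow> (('g::finite) entire_fun \<Rightarrow> 'g entire_fun \<Rightarrow> 'b) \<Rightarrow> bool" where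
  "bilinear_map sc B \<longleftrightarrow> (\<forall>f. Vector_Spaces.linear scale_entire sc (B f)) \<and>
                        (\<forall>h. Vector_Spaces.linear scale_entire sc (\<lambda>f. B f h))"

lemma free_extend_tensor_eq:
  assumes sc: "vector_space sc" and B: "bilinear_map sc B" and "tensor_eq x y"
  shows "free_extend sc (case_prod B) x = free_extend sc (case_prod B) y"
proof -
  interpret v: vector_space sc by fact
  let ?E = "free_extend sc (case_prod B)"
  interpret E: Vector_Spaces.linear free_scale sc ?E by (rule linear_free_extend[OF sc])
  have B1: "B (f + f') h = B f h + B f' h" "B (scale_entire c f) h = sc c (B f h)" for f f' h c
  proof -
    interpret Vector_Spaces.linear scale_entire sc "\<lambda>f. B f h"
      using B by (simp add: bilinear_map_def)
    show "B (f + f') h = B f h + B f' h" "B (scale_entire c f) h = sc c (B f h)"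
      by (rule add scale)+
  qed
  have B2: "B f (h + h') = B f h + B f h'" "B f (scale_entire c h) = sc c (B f h)" for f h h' c
  proof -
    interpret Vector_Spaces.linear scale_entire sc "B f"
      using B by (simp add: bilinear_map_def)
    show "B f (h + h') = B f h + B f h'" "B f (scale_entire c h) = sc c (B f h)"
      by (rule add scale)+
  qed
  have "?E r = 0" if "r \<in> bilinearity_relations" for r
    using that by (auto simp: bilinearity_relations_def E.diff E.add E.scale free_extend_single[OF sc] B1 B2)
  moreover have "x - y \<in> free.span bilinearity_relations"
    using assms(3) by (simp add: tensor_eq_def)
  ultimately have "?E (x - y) = 0" by (rule E.eq_0_on_span)
  then show ?thesis by (simp add: E.diff)
qed

lemma tensor_lift_tensor:
  assumes sc: "vector_space sc" and B: "bilinear_map sc B"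
  shows "tensor_lift sc B (tensor f h) = B f h"
proof -
  interpret v: vector_space sc by fact
  have "tensor_eq (rep_tensor (tensor f h)) (formal_tensor f h)"
    unfolding tensor.abs_eq
    by (rule rep_abs_rsp_left[OF Quotient3_tensor equivp_reflp[OF equivp_tensor_eq]])
  from free_extend_tensor_eq[OF sc B this] show ?thesis
    by (simp add: tensor_lift_def free_extend_single[OF sc])
qed

lemma linear_tensor_lift:
  assumes sc: "vector_space sc" and B: "bilinear_map sc B"
  shows "Vector_Spaces.linear scale_tensor sc (tensor_lift sc B)"
proof -
  interpret v: vector_space sc by fact
  interpret E: Vector_Spaces.linear free_scale sc "free_extend sc (case_prod B)"
    by (rule linear_free_extend[OF sc])
  have abs: "tensor_lift sc B (abs_tensor x) = free_extend sc (case_prod B) x" for x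
    unfolding tensor_lift_def
    by (rule free_extend_tensor_eq[OF sc B])
      (rule rep_abs_rsp_left[OF Quotient3_tensor equivp_reflp[OF equivp_tensor_eq]])
  show ?thesis
  proof (rule vector_space_linearI[OF tensor.vector_space_axioms sc])
    fix x y show "tensor_lift sc B (x + y) = tensor_lift sc B x + tensor_lift sc B y"
      by (induct x rule: tensor.abs_induct, induct y rule: tensor.abs_induct) (simp add: plus_tensor.abs_eq abs E.add)
  next
    fix c x show "tensor_lift sc B (scale_tensor c x) = sc c (tensor_lift sc B x)"
      by (induct x rule: tensor.abs_induct) (simp add: scale_tensor.abs_eq abs E.scale)
  qed
qed

definition baker_hirota :: "'g::finite \<Rightarrow> 'g tensor \<Rightarrow> 'g tensor" where
  "baker_hirota i = tensor_lift scale_tensor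
     (\<lambda>f h. tensor (partial_entire i f) h - tensor f (partial_entire i h))"

definition tensor_mult :: "('g::finite) tensor \<Rightarrow> 'g entire_fun" where
  "tensor_mult = tensor_lift scale_entire (*)"

lemma bilinear_map_baker_hirota:
  "bilinear_map scale_tensor
     (\<lambda>f h. tensor (partial_entire i f) h - tensor f (partial_entire i h))"
  unfolding bilinear_map_def
  by (auto intro!: vector_space_linearI entire.vector_space_axioms tensor.vector_space_axioms
      simp: tensor_bilinear partial_entire_add partial_entire_scale tensor.scale_right_diff_distrib)

lemma bilinear_map_mult: "bilinear_map scale_entire (*)"
  unfolding bilinear_map_def
  by (intro allI conjI vector_space_linearI entire.vector_space_axioms;
      transfer; simp add: algebra_simps)

lemma linear_baker_hirota: "Vector_Spaces.linear scale_tensor scale_tensor (baker_hirota i)"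
  unfolding baker_hirota_def
  by (rule linear_tensor_lift[OF tensor.vector_space_axioms bilinear_map_baker_hirota])

lemma baker_hirota_tensor:
  "baker_hirota i (tensor f h) = tensor (partial_entire i f) h - tensor f (partial_entire i h)"
  unfolding baker_hirota_def
  by (rule tensor_lift_tensor[OF tensor.vector_space_axioms bilinear_map_baker_hirota])

lemma linear_tensor_mult: "Vector_Spaces.linear scale_tensor scale_entire tensor_mult"
  unfolding tensor_mult_def
  by (rule linear_tensor_lift[OF entire.vector_space_axioms bilinear_map_mult])

lemma tensor_mult_tensor: "tensor_mult (tensor f h) = f * h"
  unfolding tensor_mult_def
  by (rule tensor_lift_tensor[OF entire.vector_space_axioms bilinear_map_mult])

definition Q_function :: "('g::finite) entire_fun \<Rightarrow> 'g list \<Rightarrow> complex^'g \<Rightarrow> complex" where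
  "Q_function \<sigma> idx u =
     - 1 / (2 * (fun_of \<sigma> u)\<^sup>2) *
     fun_of (tensor_mult (foldr baker_hirota idx (tensor \<sigma> \<sigma>))) u"


section \<open>The curve\<close>

text \<open>An element of \<open>complex poly poly\<close> is a polynomial in \<open>y\<close> with coefficients in
  \<open>complex[x]\<close>.\<close>

definition eval2 :: "complex poly poly \<Rightarrow> complex \<times> complex \<Rightarrow> complex" where
  "eval2 h p = poly (poly h [:snd p:]) (fst p)"

definition diff_x :: "complex poly poly \<Rightarrow> complex poly poly" where
  "diff_x h = map_poly pderiv h"

definition diff_y :: "complex poly poly \<Rightarrow> complex poly poly" where
  "diff_y h = pderiv h"

definition curve_poly :: "nat \<Rightarrow> (nat \<Rightarrow> complex poly) \<Rightarrow> complex poly poly" where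
  "curve_poly N q = Polynomial.monom 1 N + (\<Sum>j = 1..N-1. Polynomial.monom (q j) (N - j)) - Polynomial.monom (q N) 0"

definition affine_curve :: "complex poly poly \<Rightarrow> (complex \<times> complex) set" where
  "affine_curve f = {p. eval2 f p = 0}"

definition nonsingular :: "complex poly poly \<Rightarrow> bool" where
  "nonsingular f \<longleftrightarrow>
     (\<forall>p\<in>affine_curve f. eval2 (diff_x f) p \<noteq> 0 \<or> eval2 (diff_y f) p \<noteq> 0)"

definition is_Ns_curve :: "nat \<Rightarrow> nat \<Rightarrow> (nat \<Rightarrow> complex poly) \<Rightarrow> bool" where
  "is_Ns_curve N s q \<longleftrightarrow>
     2 \<le> N \<and> N < s \<and> coprime N s \<and>
     (\<forall>j\<in>{1..N}. degree (q j) \<le> j * s div N) \<and>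
     degree (q N) = s \<and> lead_coeff (q N) = 1 \<and>
     nonsingular (curve_poly N q)"

definition curve_genus :: "nat \<Rightarrow> nat \<Rightarrow> nat" where
  "curve_genus N s = (N - 1) * (s - 1) div 2"

text \<open>There is a single point at infinity, so the topological space underlying the compact Riemann
  surface is the one-point compactification of the affine curve; \<open>None\<close> is the point \<open>\<infinity>\<close>.\<close>

definition compact_curve :: "complex poly poly \<Rightarrow> (complex \<times> complex) option topology" where
  "compact_curve f = Alexandroff_compactification (top_of_set (affine_curve f))"


section \<open>Differentials, cycles and periods\<close>

text \<open>The value at \<open>p\<close>, on a vector \<open>v\<close> tangent to the curve, of the differential \<open>h dx/f\<^sub>y\<close>. Since
  \<open>f\<^sub>x dx + f\<^sub>y dy = 0\<close> on the curve, \<open>dx/f\<^sub>y = - dy/f\<^sub>x\<close>, which is used at the branch points \<open>f\<^sub>y = 0\<close>.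
  As the affine curve is non-singular, the differentials that are regular on it are exactly the
  \<open>h dx/f\<^sub>y\<close> with \<open>h\<close> a polynomial; they are of the second kind with a pole at most at \<open>\<infinity>\<close>.\<close>

definition differential ::
    "complex poly poly \<Rightarrow> complex poly poly \<Rightarrow> complex \<times> complex \<Rightarrow> complex \<times> complex \<Rightarrow> complex" where
  "differential f h p v =
     (if eval2 (diff_y f) p \<noteq> 0 then eval2 h p * fst v / eval2 (diff_y f) p
      else - (eval2 h p * snd v / eval2 (diff_x f) p))"

definition path_integral ::
    "complex poly poly \<Rightarrow> complex poly poly \<Rightarrow> (real \<Rightarrow> complex \<times> complex) \<Rightarrow> real \<Rightarrow> real \<Rightarrow> complex" where
  "path_integral f h \<gamma> a b =
     integral {a..b} (\<lambda>t. differential f h (\<gamma> t) (vector_derivative \<gamma> (at t)))"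

text \<open>Exponents \<open>(a, b)\<close> of the monomials \<open>x\<^sup>a y\<^sup>b\<close> for which \<open>x\<^sup>a y\<^sup>b dx/f\<^sub>y\<close> is holomorphic at
  \<open>\<infinity>\<close>, where \<open>x\<close> and \<open>y\<close> have poles of order \<open>N\<close> and \<open>s\<close> and \<open>dx/f\<^sub>y\<close> has a zero of order
  \<open>2g - 2 = (N-1)(s-1) - 2\<close>. They are listed by increasing pole order.\<close>

definition standard_exponents :: "nat \<Rightarrow> nat \<Rightarrow> ('g::{finite,linorder} \<Rightarrow> nat \<times> nat) \<Rightarrow> bool" where
  "standard_exponents N s e \<longleftrightarrow>
     bij_betw e UNIV {(a, b). N * a + s * b \<le> (N - 1) * (s - 1) - 2} \<and>
     strict_mono (\<lambda>i. N * fst (e i) + s * snd (e i))"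

definition monomial_xy :: "nat \<times> nat \<Rightarrow> complex poly poly" where
  "monomial_xy e = Polynomial.monom (Polynomial.monom 1 (fst e)) (snd e)"

definition loop_on :: "complex poly poly \<Rightarrow> (real \<Rightarrow> complex \<times> complex) \<Rightarrow> bool" where
  "loop_on f \<gamma> \<longleftrightarrow>
     valid_path \<gamma> \<and> path_image \<gamma> \<subseteq> affine_curve f \<and> pathfinish \<gamma> = pathstart \<gamma>"

definition loop_chain :: "(real \<Rightarrow> complex \<times> complex) \<Rightarrow> (complex \<times> complex) option chain" where
  "loop_chain \<gamma> = frag_of (restrict (\<lambda>x. Some (\<gamma> (x 1))) (standard_simplex 1))"

abbreviation homologous_on_curve ::
    "complex poly poly \<Rightarrow> (complex \<times> complex) option chain \<Rightarrow> (complex \<times> complex) option chain \<Rightarrow> bool" where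
  "homologous_on_curve f \<equiv> homologous_rel 1 (compact_curve f) {}"

text \<open>Tangent vectors \<open>v, w\<close> at a point of the curve lie in one complex line, so \<open>w = \<lambda> v\<close>;
  \<open>tangent_orientation v w\<close> is \<open>\<bar>v\<bar>\<^sup>2 Im \<lambda>\<close>, whose sign is that of the basis \<open>(v, w)\<close> for the
  complex orientation.\<close>

definition tangent_orientation :: "complex \<times> complex \<Rightarrow> complex \<times> complex \<Rightarrow> real" where
  "tangent_orientation v w = Im (cnj (fst v) * fst w + cnj (snd v) * snd w)"

definition crossings ::
    "(real \<Rightarrow> complex \<times> complex) \<Rightarrow> (real \<Rightarrow> complex \<times> complex) \<Rightarrow> (real \<times> real) set" where
  "crossings a b = {(t, t'). t \<in> {0..1} \<and> t' \<in> {0..1} \<and> a t = b t'}"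

definition transversal ::
    "(real \<Rightarrow> complex \<times> complex) \<Rightarrow> (real \<Rightarrow> complex \<times> complex) \<Rightarrow> bool" where
  "transversal a b \<longleftrightarrow> finite (crossings a b) \<and>
     (\<forall>(t, t') \<in> crossings a b. t \<in> {0<..<1} \<and> t' \<in> {0<..<1} \<and>
        a differentiable (at t) \<and> b differentiable (at t') \<and>
        tangent_orientation (vector_derivative a (at t)) (vector_derivative b (at t')) \<noteq> 0)"

text \<open>The intersection number of the homology classes of two loops is the signed number of crossings
  of any transversal pair of loops in these classes.\<close>

definition intersection_number ::
    "complex poly poly \<Rightarrow> (real \<Rightarrow> complex \<times> complex) \<Rightarrow> (real \<Rightarrow> complex \<times> complex) \<Rightarrow> int \<Rightarrow> bool" where
  "intersection_number f \<alpha> \<beta> k \<longleftrightarrow>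
     (\<exists>a b. loop_on f a \<and> loop_on f b \<and>
        homologous_on_curve f (loop_chain a) (loop_chain \<alpha>) \<and>
        homologous_on_curve f (loop_chain b) (loop_chain \<beta>) \<and>
        transversal a b \<and>
        real_of_int k = (\<Sum>(t, t') \<in> crossings a b.
          sgn (tangent_orientation (vector_derivative a (at t)) (vector_derivative b (at t')))))"

text \<open>Every class in \<open>H\<^sub>1\<close> is represented by a piecewise continuously differentiable loop avoiding
  \<open>\<infinity>\<close>, so the members of a symplectic basis are given by such loops.\<close>

definition symplectic_basis ::
    "complex poly poly \<Rightarrow> ('g::finite \<Rightarrow> real \<Rightarrow> complex \<times> complex) \<Rightarrow>
     ('g \<Rightarrow> real \<Rightarrow> complex \<times> complex) \<Rightarrow> bool" where
  "symplectic_basis f \<alpha> \<beta> \<longleftrightarrow>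
     (\<forall>i. loop_on f (\<alpha> i) \<and> loop_on f (\<beta> i)) \<and>
     (\<forall>z. singular_relcycle 1 (compact_curve f) {} z \<longrightarrow>
        (\<exists>!(m, n). homologous_on_curve f z
           (\<Sum>i\<in>UNIV. frag_cmul (m i) (loop_chain (\<alpha> i)) + frag_cmul (n i) (loop_chain (\<beta> i))))) \<and>
     (\<forall>i j. intersection_number f (\<alpha> i) (\<alpha> j) 0 \<and> intersection_number f (\<beta> i) (\<beta> j) 0 \<and>
            intersection_number f (\<alpha> i) (\<beta> j) (if i = j then 1 else 0))"

definition period_matrix ::
    "complex poly poly \<Rightarrow> ('g::finite \<Rightarrow> complex poly poly) \<Rightarrow> ('g \<Rightarrow> real \<Rightarrow> complex \<times> complex) \<Rightarrow>
     complex^'g^'g" where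
  "period_matrix f h \<gamma> = (\<chi> k l. path_integral f (h k) (\<gamma> l) 0 1)"

text \<open>The relation makes the \<open>2g \<times> 2g\<close> matrix of all four blocks invertible, so that the classes of
  the differentials of the first and second kind together form a basis of the first de Rham
  cohomology of the curve.\<close>

definition legendre_relation ::
    "complex^'g^'g \<Rightarrow> complex^'g^'g \<Rightarrow> complex^'g^'g \<Rightarrow> complex^('g::finite)^'g \<Rightarrow> bool" where
  "legendre_relation \<omega>1 \<omega>2 \<eta>1 \<eta>2 \<longleftrightarrow>
     invertible \<omega>1 \<and>
     transpose (\<eta>1 ** matrix_inv \<omega>1) = \<eta>1 ** matrix_inv \<omega>1 \<and>
     \<eta>2 = \<eta>1 ** matrix_inv \<omega>1 ** \<omega>2 - mat (2 * pi * \<i>) ** transpose (matrix_inv \<omega>1)"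


section \<open>The Jacobian and its strata\<close>

definition cvec_of_int :: "int^'g::finite \<Rightarrow> complex^'g" where
  "cvec_of_int m = (\<chi> i. of_int (m $ i))"

definition cvec_of_real :: "real^'g::finite \<Rightarrow> complex^'g" where
  "cvec_of_real x = (\<chi> i. of_real (x $ i))"

definition period_vector :: "complex^'g^'g \<Rightarrow> complex^'g^'g \<Rightarrow> int^'g \<Rightarrow> int^('g::finite) \<Rightarrow> complex^'g" where
  "period_vector \<omega>1 \<omega>2 m n = \<omega>1 *v cvec_of_int m + \<omega>2 *v cvec_of_int n"

definition period_lattice :: "complex^'g^'g \<Rightarrow> complex^'g^'g \<Rightarrow> (complex^'g::finite) set" where
  "period_lattice \<omega>1 \<omega>2 = {period_vector \<omega>1 \<omega>2 m n | m n. True}"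

text \<open>The quotient map to the Jacobian, whose points are the cosets of the period lattice.\<close>

definition kappa :: "(complex^'g::finite) set \<Rightarrow> complex^'g \<Rightarrow> (complex^'g) set" where
  "kappa \<Lambda> u = (+) u ` \<Lambda>"

text \<open>\<open>w\<close> is a value of the integral of the vector of differentials \<open>h k dx/f\<^sub>y\<close> over a path on
  the compact curve from \<open>\<infinity>\<close> to \<open>P\<close>. The path is at \<open>\<infinity>\<close> only at parameter \<open>0\<close>, and the integral
  is improper there. For \<open>P = \<infinity>\<close> it suffices to consider the constant path, since the values are
  only used modulo the period lattice.\<close>

definition abel_integral ::
    "complex poly poly \<Rightarrow> ('g::finite \<Rightarrow> complex poly poly) \<Rightarrow> (complex \<times> complex) option \<Rightarrow>
     complex^'g \<Rightarrow> bool" where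
  "abel_integral f h P w \<longleftrightarrow>
     (case P of
        None \<Rightarrow> w = 0
      | Some p \<Rightarrow> \<exists>\<gamma>. pathin (compact_curve f) (\<lambda>t. if t = 0 then None else Some (\<gamma> t)) \<and> \<gamma> 1 = p \<and>
          (\<forall>\<epsilon>\<in>{0<..<1}. \<gamma> piecewise_C1_differentiable_on {\<epsilon>..1}) \<and>
          (\<forall>k. ((\<lambda>\<epsilon>. path_integral f (h k) \<gamma> \<epsilon> 1) \<longlongrightarrow> w $ k) (at_right 0)))"

definition W_stratum ::
    "complex poly poly \<Rightarrow> ('g::finite \<Rightarrow> complex poly poly) \<Rightarrow> (complex^'g) set \<Rightarrow> nat \<Rightarrow>
     (complex^'g) set set" where
  "W_stratum f h \<Lambda> k =
     {kappa \<Lambda> (\<Sum>j<k. w j) | w. \<forall>j<k. \<exists>P\<in>topspace (compact_curve f). abel_integral f h P (w j)}"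

definition Theta_stratum ::
    "complex poly poly \<Rightarrow> ('g::finite \<Rightarrow> complex poly poly) \<Rightarrow> (complex^'g) set \<Rightarrow> nat \<Rightarrow>
     (complex^'g) set set" where
  "Theta_stratum f h \<Lambda> k = W_stratum f h \<Lambda> k \<union> (\<lambda>x. uminus ` x) ` W_stratum f h \<Lambda> k"


section \<open>The sigma function\<close>

definition theta_char ::
    "complex^'g^'g \<Rightarrow> real^'g \<Rightarrow> real^'g \<Rightarrow> complex^('g::finite) \<Rightarrow> complex" where
  "theta_char \<tau> \<delta>1 \<delta>2 z =
     (\<Sum>\<^sub>\<infinity>m\<in>UNIV. let v = cvec_of_int m + cvec_of_real \<delta>2 in
        exp (2 * pi * \<i> * (1/2 * scalar_product v (\<tau> *v v) + scalar_product v (z + cvec_of_real \<delta>1))))"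

text \<open>The Riemann constant with base point \<open>\<infinity>\<close>, normalised as in Riemann's theorem: if
  \<open>P \<mapsto> \<theta>(A(P) - e)\<close>, with \<open>A\<close> the Abel map, has exactly \<open>g\<close> zeros \<open>P\<^sub>1, ..., P\<^sub>g\<close> on the curve, then
  \<open>A(P\<^sub>1) + ... + A(P\<^sub>g) = e - \<delta>\<close> in the Jacobian. It suffices to consider \<open>e\<close> for which the zeros are
  distinct, which is the generic case.\<close>

definition riemann_constant ::
    "complex poly poly \<Rightarrow> ('g::finite \<Rightarrow> complex poly poly) \<Rightarrow> complex^'g^'g \<Rightarrow> complex^'g^'g \<Rightarrow>
     complex^'g \<Rightarrow> bool" where
  "riemann_constant f h \<omega>1 \<omega>2 \<delta> \<longleftrightarrow>
     (\<forall>e Ps A. card Ps = CARD('g) \<and>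
        Ps = {P \<in> topspace (compact_curve f). \<exists>w. abel_integral f h P w \<and>
                theta_char (matrix_inv \<omega>1 ** \<omega>2) 0 0 (matrix_inv \<omega>1 *v (w - e)) = 0} \<and>
        (\<forall>P\<in>Ps. abel_integral f h P (A P)) \<longrightarrow>
        (\<Sum>P\<in>Ps. A P) - (e - \<delta>) \<in> period_lattice \<omega>1 \<omega>2)"

definition sigma_function ::
    "complex \<Rightarrow> complex^'g^'g \<Rightarrow> complex^'g^'g \<Rightarrow> complex^'g^'g \<Rightarrow> real^'g \<Rightarrow> real^'g \<Rightarrow>
     complex^('g::finite) \<Rightarrow> complex" where
  "sigma_function c \<omega>1 \<omega>2 \<eta>1 \<delta>1 \<delta>2 u =
     c * exp (1/2 * scalar_product u ((\<eta>1 ** matrix_inv \<omega>1) *v u)) *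
     theta_char (matrix_inv \<omega>1 ** \<omega>2) \<delta>1 \<delta>2 (matrix_inv \<omega>1 *v u)"

definition sigma_chi :: "real^'g \<Rightarrow> real^'g \<Rightarrow> int^'g \<Rightarrow> int^('g::finite) \<Rightarrow> complex" where
  "sigma_chi \<delta>1 \<delta>2 m n =
     exp (2 * pi * \<i> * (scalar_product (cvec_of_int m) (cvec_of_real \<delta>2)
       - scalar_product (cvec_of_int n) (cvec_of_real \<delta>1)
       + 1/2 * scalar_product (cvec_of_int m) (cvec_of_int n)))"

definition sigma_L ::
    "complex^'g^'g \<Rightarrow> complex^'g^'g \<Rightarrow> complex^'g^'g \<Rightarrow> complex^'g^'g \<Rightarrow> int^'g \<Rightarrow> int^'g \<Rightarrow>
     complex^('g::finite) \<Rightarrow> complex" where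
  "sigma_L \<omega>1 \<omega>2 \<eta>1 \<eta>2 m n u =
     scalar_product (u + (1/2) *s period_vector \<omega>1 \<omega>2 m n)
       (\<eta>1 *v cvec_of_int m + \<eta>2 *v cvec_of_int n)"


section \<open>Abelian functions\<close>

text \<open>With \<open>Z\<close> the preimage of the theta divisor. Periodicity is an identity of meromorphic functions,
  so it is required away from \<open>Z\<close>, where the representing total function is holomorphic.\<close>

definition abelian_function ::
    "(complex^'g::finite) set \<Rightarrow> (complex^'g) set \<Rightarrow> (complex^'g \<Rightarrow> complex) \<Rightarrow> bool" where
  "abelian_function \<Lambda> Z M \<longleftrightarrow>
     meromorphic_cn M \<and>
     (\<forall>u. u \<notin> Z \<longrightarrow> (\<exists>U. open U \<and> u \<in> U \<and> holomorphic_cn U M)) \<and>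
     (\<forall>l\<in>\<Lambda>. \<forall>u. u \<notin> Z \<longrightarrow> M (u + l) = M u)"

end

(* A lattice translation multiplies \<sigma> by E = \<chi> exp L with L affine, so that each \<partial>E/\<partial>u\<^sub>i is a
   constant multiple of E. The two terms containing this constant cancel in D\<^sub>i (E f \<otimes> E h), hence
   D\<^sub>i acts on E f \<otimes> E h as on f \<otimes> h, and the numerator and the denominator of Q both acquire
   the factor E\<^sup>2. The denominator \<sigma>\<^sup>2 is nonzero off Z, and vanishes on no open set because the
   zeros of \<sigma> are generically simple. *)

theory Submission
  imports Defs
begin

lemma holomorphic_cn_divide:
  assumes "holomorphic_cn U f" "holomorphic_cn U g" "\<And>u. u \<in> U \<Longrightarrow> g u \<noteq> 0"
  shows "holomorphic_cn U (\<lambda>u. f u / g u)"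
  unfolding holomorphic_cn_def
proof
  fix u assume u: "u \<in> U"
  obtain D where D: "(f has_derivative D) (at u)" "\<And>c v. D (c *s v) = c * D v"
    using assms(1) u unfolding holomorphic_cn_def by blast
  obtain D' where D': "(g has_derivative D') (at u)" "\<And>c v. D' (c *s v) = c * D' v"
    using assms(2) u unfolding holomorphic_cn_def by blast
  from has_derivative_divide[OF D(1) D'(1) assms(3)[OF u]]
  show "\<exists>D. ((\<lambda>u. f u / g u) has_derivative D) (at u) \<and> (\<forall>c v. D (c *s v) = c * D v)"
    by (intro exI conjI) (assumption, simp add: D(2) D'(2) algebra_simps diff_divide_distrib)
qed

lemma holomorphic_cn_subset: "holomorphic_cn U f \<Longrightarrow> V \<subseteq> U \<Longrightarrow> holomorphic_cn V f"
  unfolding holomorphic_cn_def by blast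

lemma partial_eq_0_if_vanishes_on_open:
  assumes V: "open V" "u \<in> V" "\<And>v. v \<in> V \<Longrightarrow> f v = 0"
  shows "partial i f u = 0"
proof -
  have "(f has_derivative (\<lambda>_. 0)) (at u)"
    by (rule has_derivative_transform_within_open[OF has_derivative_const V(1,2)]) (simp add: V(3))
  from partial_eq[OF this] show ?thesis by simp
qed

text \<open>If f vanished on all of V, then V would be a nonempty open subset of Z. Order one then
  supplies a point of V with a nonzero partial derivative, although f is constant near it.\<close>

lemma nonzero_on_open_if_vanishes_order_one:
  assumes "vanishes_exactly_along_order_one f Z" "open V" "V \<noteq> {}"
  shows "\<exists>v\<in>V. f v \<noteq> 0"
proof (rule ccontr)
  assume "\<not> ?thesis"
  then have 0: "f v = 0" if "v \<in> V" for v using that by blast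
  with assms obtain u i where "u \<in> V" "partial i f u \<noteq> 0"
    unfolding vanishes_exactly_along_order_one_def by fast
  moreover from this(1) have "partial i f u = 0"
    by (rule partial_eq_0_if_vanishes_on_open[OF assms(2) _ 0])
  ultimately show False by blast
qed

text \<open>Inside the algebra, quasi-periodicity becomes the equation
  \<open>translate_entire l S = Entire E * S\<close>.\<close>

lift_definition translate_entire :: "complex^'g \<Rightarrow> ('g::finite) entire_fun \<Rightarrow> 'g entire_fun"
  is "\<lambda>l f u. f (u + l)"
proof -
  fix l and f :: "complex^'g \<Rightarrow> complex" assume f: "entire_cn f"
  show "entire_cn (\<lambda>u. f (u + l))"
  proof (rule holomorphic_cnI)
    fix u
    have "((\<lambda>u. u + l) has_derivative (\<lambda>v. v)) (at u)" by (auto intro!: derivative_eq_intros)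
    from diff_chain_at[OF this holomorphic_cn_has_derivative[OF f UNIV_I]]
    show "((\<lambda>u. f (u + l)) has_derivative (\<lambda>v. \<Sum>i\<in>UNIV. partial i f (u + l) * v $ i)) (at u)"
      by (simp add: o_def)
  qed
qed

lemma partial_entire_translate:
  "partial_entire i (translate_entire l f) = translate_entire l (partial_entire i f)"
  by transfer (simp add: partial_def fun_eq_iff add_ac)

lemma translate_entire_arith:
  "translate_entire l (f * h) = translate_entire l f * translate_entire l h"
  "translate_entire l (f - h) = translate_entire l f - translate_entire l h"
  by (transfer; simp)+

lemma partial_entire_mult:
  "partial_entire i (f * h) = partial_entire i f * h + f * partial_entire i h"
proof transfer
  fix i and f h :: "complex^'g \<Rightarrow> complex" assume f: "entire_cn f" and h: "entire_cn h"
  have "((\<lambda>u. f u * h u) has_derivative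
      (\<lambda>v. \<Sum>j\<in>UNIV. (partial j f u * h u + f u * partial j h u) * (v $ j))) (at u)" for u
    using has_derivative_mult[OF holomorphic_cn_has_derivative[OF f UNIV_I]
        holomorphic_cn_has_derivative[OF h UNIV_I]]
    by (simp add: sum.distrib distrib_right distrib_left sum_distrib_left sum_distrib_right mult_ac add_ac)
  then show "partial i (\<lambda>u. f u * h u) = (\<lambda>u. partial i f u * h u + f u * partial i h u)"
    by (intro ext partial_eqI)
qed

lemma foldr_baker_hirota_diff:
  "foldr baker_hirota idx (x - y) = foldr baker_hirota idx x - foldr baker_hirota idx y"
proof (induction idx)
  case (Cons i idx)
  interpret Vector_Spaces.linear scale_tensor scale_tensor "baker_hirota i"
    by (rule linear_baker_hirota)
  from Cons show ?case by (simp add: diff)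
qed simp

text \<open>Two separate arguments are kept because the recursion leaves the diagonal: a single
  operator turns \<open>tensor f f\<close> into \<open>tensor (partial_entire i f) f - tensor f
  (partial_entire i f)\<close>.\<close>

definition hirota_product ::
    "'g list \<Rightarrow> 'g entire_fun \<Rightarrow> 'g entire_fun \<Rightarrow> ('g::finite) entire_fun" where
  "hirota_product idx f h = tensor_mult (foldr baker_hirota idx (tensor f h))"

lemma hirota_product_Nil: "hirota_product [] f h = f * h"
  by (simp add: hirota_product_def tensor_mult_tensor)

text \<open>\<open>foldr\<close> applies the last index first, hence to a pure tensor, where
  \<open>baker_hirota_tensor\<close> is explicit; linearity carries the difference through the
  remaining operators. Inductions on the index list therefore run from its end.\<close>

lemma hirota_product_snoc:
  "hirota_product (idx @ [i]) f h =
     hirota_product idx (partial_entire i f) h - hirota_product idx f (partial_entire i h)"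
proof -
  interpret Vector_Spaces.linear scale_tensor scale_entire tensor_mult
    by (rule linear_tensor_mult)
  show ?thesis
    by (simp add: hirota_product_def baker_hirota_tensor foldr_baker_hirota_diff diff)
qed

text \<open>Allows the eigenvalue terms of an exponential factor to be pulled out of either
  argument.\<close>

lemma hirota_product_bilinear:
  "hirota_product idx (f + f') h = hirota_product idx f h + hirota_product idx f' h"
  "hirota_product idx f (h + h') = hirota_product idx f h + hirota_product idx f h'"
  "hirota_product idx (scale_entire c f) h = scale_entire c (hirota_product idx f h)"
  "hirota_product idx f (scale_entire c h) = scale_entire c (hirota_product idx f h)"
proof (induction idx arbitrary: f f' h h' rule: rev_induct)
  case Nil
  { case 1 show ?case by (simp add: hirota_product_Nil distrib_right) }
  { case 2 show ?case by (simp add: hirota_product_Nil distrib_left) }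
  { case 3 show ?case unfolding hirota_product_Nil by transfer (simp add: fun_eq_iff mult_ac) }
  { case 4 show ?case unfolding hirota_product_Nil by transfer (simp add: fun_eq_iff mult_ac) }
next
  case (snoc i idx)
  { case 1 show ?case by (simp add: hirota_product_snoc partial_entire_add snoc) }
  { case 2 show ?case by (simp add: hirota_product_snoc partial_entire_add snoc) }
  { case 3 show ?case
      by (simp add: hirota_product_snoc partial_entire_scale snoc entire.scale_right_diff_distrib) }
  { case 4 show ?case
      by (simp add: hirota_product_snoc partial_entire_scale snoc entire.scale_right_diff_distrib) }
qed

text \<open>Translation commutes with partial derivatives and respects products and differences,
  which are the only operations in the recursion.\<close>

lemma hirota_product_translate:
  "hirota_product idx (translate_entire l f) (translate_entire l h) =
     translate_entire l (hirota_product idx f h)"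
  by (induction idx arbitrary: f h rule: rev_induct)
    (simp_all add: hirota_product_Nil hirota_product_snoc partial_entire_translate
      translate_entire_arith)

lemma hirota_product_exponential_factor:
  assumes E: "\<And>i. partial_entire i E = scale_entire (a i) E"
  shows "hirota_product idx (E * f) (E * h) = E * E * hirota_product idx f h"
proof (induction idx arbitrary: f h rule: rev_induct)
  case Nil
  show ?case by (simp add: hirota_product_Nil mult_ac)
next
  case (snoc i idx)
  \<comment> \<open>The eigenvalue stays a scalar on the whole product \<open>E * f\<close>. By
    bilinearity both halves of the difference contribute
    \<open>scale_entire (a i) (hirota_product idx (E * f) (E * h))\<close>, with opposite
    signs.\<close>
  have "partial_entire i (E * f) = scale_entire (a i) (E * f) + E * partial_entire i f" for f
    unfolding partial_entire_mult E by transfer (simp add: fun_eq_iff mult_ac)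
  then show ?case
    by (simp add: hirota_product_snoc hirota_product_bilinear snoc right_diff_distrib)
qed

text \<open>The coefficient of \<open>v $ i\<close> is arranged as \<open>w $ i\<close> times the
  function itself, so the eigenvalue under each partial derivative can be read off.\<close>

lemma exp_affine_has_derivative:
  fixes b w :: "complex^'g::finite"
  shows "((\<lambda>u. k * exp (scalar_product (u + b) w)) has_derivative
     (\<lambda>v. \<Sum>i\<in>UNIV. w $ i * (k * exp (scalar_product (u + b) w)) * (v $ i))) (at u)"
proof -
  have "((\<lambda>u. scalar_product (u + b) w) has_derivative (\<lambda>v. \<Sum>i\<in>UNIV. v $ i * w $ i)) (at u)"
    unfolding scalar_product_def vector_add_component
  proof (rule has_derivative_sum)
    fix i
    have "((\<lambda>u. u $ i) has_derivative (\<lambda>v. v $ i)) (at u)"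
      by (rule bounded_linear_imp_has_derivative[OF bounded_linear_vec_nth])
    then show "((\<lambda>u. (u $ i + b $ i) * w $ i) has_derivative (\<lambda>v. v $ i * w $ i)) (at u)"
      by (intro has_derivative_mult_left) (rule has_derivative_add_const)
  qed
  from has_derivative_mult_right[OF has_derivative_compose[OF this
      DERIV_exp[THEN has_field_derivative_imp_has_derivative]], of k]
  show ?thesis by (simp add: sum_distrib_left mult_ac)
qed

lemma fun_of_arith:
  "fun_of (f * h) u = fun_of f u * fun_of h u"
  "fun_of (scale_entire c f) u = c * fun_of f u"
  "fun_of (translate_entire l f) u = fun_of f (u + l)"
  "fun_of (- f) u = - fun_of f u"
  by (transfer; simp)+

lemma entire_cn_fun_of: "entire_cn (fun_of f)"
  using fun_of[of f] by simp

text \<open>The constant moves into the numerator, leaving a global quotient of two entire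
  functions. At zeros of f both sides are 0, since division by 0 gives 0.\<close>

lemma Q_function_eq_divide:
  "Q_function f idx u =
     fun_of (scale_entire (- 1 / 2) (hirota_product idx f f)) u / fun_of (f * f) u"
  by (simp add: Q_function_def hirota_product_def fun_of_arith power2_eq_square mult_ac)

text \<open>Numerator and denominator both gain the square of E, which cancels. A zero of f at u
  gives one at \<open>u + l\<close>, where the convention for division by 0 makes both sides
  0.\<close>

lemma Q_function_periodic:
  assumes f: "translate_entire l f = E * f"
    and E: "\<And>i. partial_entire i E = scale_entire (a i) E" and nz: "\<And>u. fun_of E u \<noteq> 0"
  shows "Q_function f idx (u + l) = Q_function f idx u"
proof -
  have "translate_entire l (hirota_product idx f f) = E * E * hirota_product idx f f"
    by (simp add: hirota_product_translate[symmetric] f hirota_product_exponential_factor[OF E])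
  then have "fun_of (hirota_product idx f f) (u + l) =
      fun_of E u * fun_of E u * fun_of (hirota_product idx f f) u"
    by (metis fun_of_arith(1,3))
  moreover have "fun_of f (u + l) = fun_of E u * fun_of f u"
    by (metis f fun_of_arith(1,3))
  ultimately show ?thesis
    using nz by (simp add: Q_function_eq_divide fun_of_arith)
qed

theorem theorem5p3:
  fixes N s :: nat and q :: "nat \<Rightarrow> complex poly" and f :: "complex poly poly"
    and e :: "'g::{finite,linorder} \<Rightarrow> nat \<times> nat"
    and du dr :: "'g \<Rightarrow> complex poly poly"
    and \<alpha> \<beta> :: "'g \<Rightarrow> real \<Rightarrow> complex \<times> complex"
    and \<omega>1 \<omega>2 \<eta>1 \<eta>2 :: "'g cmatrix"
    and \<delta>1 \<delta>2 :: "(real, 'g) vec"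
    and c :: complex
    and \<Lambda> Z :: "'g cvector set"
    and \<sigma> :: "'g cvector \<Rightarrow> complex"
    and n :: nat and idx :: "'g list"
  assumes curve: "is_Ns_curve N s q" "f = curve_poly N q"
    and genus: "CARD('g) = curve_genus N s"
    and du: "standard_exponents N s e" "du = (\<lambda>i. monomial_xy (e i))"
    and cycles: "symplectic_basis f \<alpha> \<beta>"
    and periods: "\<omega>1 = period_matrix f du \<alpha>" "\<omega>2 = period_matrix f du \<beta>"
      "\<eta>1 = period_matrix f dr \<alpha>" "\<eta>2 = period_matrix f dr \<beta>"
    and legendre: "legendre_relation \<omega>1 \<omega>2 \<eta>1 \<eta>2"
    and lattice: "\<Lambda> = period_lattice \<omega>1 \<omega>2"
    and theta_divisor: "Z = kappa \<Lambda> -` Theta_stratum f du \<Lambda> (CARD('g) - 1)"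
    and delta: "riemann_constant f du \<omega>1 \<omega>2 (\<omega>1 *v cvec_of_real \<delta>1 + \<omega>2 *v cvec_of_real \<delta>2)"
    and sigma: "c \<noteq> 0" "\<sigma> = sigma_function c \<omega>1 \<omega>2 \<eta>1 \<delta>1 \<delta>2"
    and known_entire: "entire_cn \<sigma>"
    and known_zeros: "vanishes_exactly_along_order_one \<sigma> Z"
    and known_quasi_periodic:
      "\<And>l1 l2 u. \<sigma> (u + period_vector \<omega>1 \<omega>2 l1 l2) =
         sigma_chi \<delta>1 \<delta>2 l1 l2 * exp (sigma_L \<omega>1 \<omega>2 \<eta>1 \<eta>2 l1 l2 u) * \<sigma> u"
    and indices: "n \<ge> 1" "length idx = n" "sorted idx"
  shows "abelian_function \<Lambda> Z (Q_function (Entire \<sigma>) idx)"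
proof -
  define S where "S = Entire \<sigma>"
  have S: "fun_of S = \<sigma>" using known_entire by (simp add: S_def Entire_inverse)
  have zeros: "{u. \<sigma> u = 0} = Z"
    using known_zeros unfolding vanishes_exactly_along_order_one_def by blast
  let ?A = "fun_of (scale_entire (- 1 / 2) (hirota_product idx S S))" and ?B = "fun_of (S * S)"
  have B0: "?B u = 0 \<longleftrightarrow> u \<in> Z" for u using zeros by (auto simp: fun_of_arith S)
  have "meromorphic_cn (Q_function S idx)"
    unfolding meromorphic_cn_def
  \<comment> \<open>One global quotient serves as the local representation at every point.\<close>
  proof (rule allI, rule exI[of _ UNIV], rule exI[of _ ?A], rule exI[of _ ?B], intro conjI allI impI)
    fix V :: "'g cvector set" assume "open V \<and> V \<subseteq> UNIV \<and> V \<noteq> {}"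
    with nonzero_on_open_if_vanishes_order_one[OF known_zeros] have "\<exists>v\<in>V. \<sigma> v \<noteq> 0" by blast
    then show "\<exists>v\<in>V. ?B v \<noteq> 0" by (simp add: fun_of_arith S)
  qed (auto simp: entire_cn_fun_of Q_function_eq_divide)
  moreover have "\<exists>U. open U \<and> u \<in> U \<and> holomorphic_cn U (Q_function S idx)" if "u \<notin> Z" for u
  \<comment> \<open>The neighbourhood is the complement of Z, open because Z is the zero set of the
    continuous \<sigma>.\<close>
  proof (intro exI conjI)
    have "continuous_on UNIV \<sigma>"
      using holomorphic_cn_continuous[OF known_entire] by (simp add: continuous_at_imp_continuous_on)
    then have "closed Z"
      unfolding zeros[symmetric] by (intro closed_Collect_eq continuous_on_const)
    then show "open (- Z)" by (rule open_Compl)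
    show "u \<in> - Z" using that by simp
    have "holomorphic_cn (- Z) (\<lambda>u. ?A u / ?B u)"
      by (intro holomorphic_cn_divide holomorphic_cn_subset[OF entire_cn_fun_of subset_UNIV])
        (simp add: B0)
    then show "holomorphic_cn (- Z) (Q_function S idx)"
      by (simp add: Q_function_eq_divide[abs_def])
  qed
  moreover have "Q_function S idx (u + l) = Q_function S idx u" if l: "l \<in> \<Lambda>" for l u
  proof -
    obtain l1 l2 where l12: "l = period_vector \<omega>1 \<omega>2 l1 l2"
      using l unfolding lattice period_lattice_def by blast
    \<comment> \<open>\<open>sigma_L\<close> pairs \<open>u + (1/2) *s l\<close> with this vector,
      so E below is the full multiplier of \<sigma> under l, and the components of a are its
      eigenvalues.\<close>
    define a where "a = \<eta>1 *v cvec_of_int l1 + \<eta>2 *v cvec_of_int l2"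
    define E where "E u = sigma_chi \<delta>1 \<delta>2 l1 l2 * exp (scalar_product (u + (1/2) *s l) a)" for u
    have dE: "(E has_derivative (\<lambda>v. \<Sum>i\<in>UNIV. a $ i * E u * (v $ i))) (at u)" for u
      unfolding E_def by (rule exp_affine_has_derivative)
    then have pE: "partial i E u = a $ i * E u" for i u by (rule partial_eqI)
    from dE have eE: "entire_cn E" by (rule holomorphic_cnI)
    then have E: "fun_of (Entire E) = E" by (simp add: Entire_inverse)
    show ?thesis
    proof (rule Q_function_periodic)
      show "translate_entire l S = Entire E * S"
        by (rule fun_of_inject[THEN iffD1], rule ext)
          (simp add: fun_of_arith E S l12 known_quasi_periodic E_def sigma_L_def a_def)
      show "partial_entire i (Entire E) = scale_entire (a $ i) (Entire E)" for i
        by (rule fun_of_inject[THEN iffD1], rule ext)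
          (simp add: fun_of_arith E partial_entire.rep_eq pE)
      \<comment> \<open>Both factors of E are values of the exponential.\<close>
      show "fun_of (Entire E) u \<noteq> 0" for u by (simp add: E E_def sigma_chi_def)
    qed
  qed
  ultimately show ?thesis unfolding abelian_function_def S_def by blast
qed

end
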